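(* Let $p>3$ be a prime. Then $$\sum_{k=0}^{p-1}\frac{\binom{2k}{k}}{2^k}H_k^{(2)}\equiv -E_{p-3}\pmod p.$$
   Context: For $n=0,1,2,\ldots$, $H_n^{(2)}:=\sum_{0<k\leqslant n}\frac{1}{k^2}$ (so $H_0^{(2)}=0$). The Euler numbers $E_0,E_1,E_2,\ldots$ are the integers given by $E_0=1$ and the recursion $\sum_{0\leqslant k\leqslant n,\ 2\mid k}\binom{n}{k}E_{n-k}=0$ for $n=1,2,3,\ldots$. Congruences modulo a power $p^a$ between rational numbers are understood in the ring of rational numbers whose denominators are not divisible by $p$. *)

theory Defs
  imports Complex_Main "HOL-Computational_Algebra.Primes"
begin

definition harm2 :: "nat \<Rightarrow> rat" where
  "harm2 n = (\<Sum>k\<in>{0<..n}. 1 / of_nat k ^ 2)"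

text \<open>
  The recursion for the Euler numbers, solved for its \<open>k = 0\<close> term; \<open>euler_num_recursion\<close> and
  \<open>euler_num_unique\<close> below relate it to the usual implicit form.
\<close>

fun euler_num :: "nat \<Rightarrow> int" where
  "euler_num n =
     (if n = 0 then 1
      else - (\<Sum>k | 0 < k \<and> k \<le> n \<and> even k. of_nat (n choose k) * euler_num (n - k)))"

declare euler_num.simps [simp del]

lemma euler_num_0: "euler_num 0 = 1"
  by (simp add: euler_num.simps)

lemma euler_recursion_split:
  fixes f :: "nat \<Rightarrow> int"
  shows "(\<Sum>k | k \<le> n \<and> even k. of_nat (n choose k) * f (n - k)) =
         f n + (\<Sum>k | 0 < k \<and> k \<le> n \<and> even k. of_nat (n choose k) * f (n - k))"
proof -
  have "{k. k \<le> n \<and> even k} = insert 0 {k. 0 < k \<and> k \<le> n \<and> even k}"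
    by auto
  moreover have "finite {k. 0 < k \<and> k \<le> n \<and> even k}"
    by (rule finite_subset [of _ "{..n}"]) auto
  ultimately show ?thesis
    by simp
qed

lemma euler_num_recursion:
  assumes "n \<ge> 1"
  shows "(\<Sum>k | k \<le> n \<and> even k. of_nat (n choose k) * euler_num (n - k)) = 0"
  using assms by (simp add: euler_recursion_split euler_num.simps [of n])

lemma euler_num_unique:
  fixes f :: "nat \<Rightarrow> int"
  assumes "f 0 = 1"
    and rec: "\<And>n. n \<ge> 1 \<Longrightarrow> (\<Sum>k | k \<le> n \<and> even k. of_nat (n choose k) * f (n - k)) = 0"
  shows "f = euler_num"
proof
  fix n
  show "f n = euler_num n"
  proof (induction n rule: less_induct)
    case (less n)
    show ?case
    proof (cases "n = 0")
      case True
      then show ?thesis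
        using assms(1) by (simp add: euler_num_0)
    next
      case False
      have "(\<Sum>k | 0 < k \<and> k \<le> n \<and> even k. of_nat (n choose k) * f (n - k)) =
            (\<Sum>k | 0 < k \<and> k \<le> n \<and> even k. of_nat (n choose k) * euler_num (n - k))"
        using less by (intro sum.cong) auto
      then show ?thesis
        using rec [of n] euler_num_recursion [of n] False
        by (simp add: euler_recursion_split)
    qed
  qed
qed

text \<open>The ring of rationals whose denominator (in lowest terms) is not divisible by \<open>p\<close>.\<close>

definition p_integral :: "nat \<Rightarrow> rat set" where
  "p_integral p = {x. \<not> int p dvd snd (quotient_of x)}"

text \<open>
  \<open>rat_cong p a x y\<close> is the congruence of \<open>x\<close> and \<open>y\<close> modulo \<open>p ^ a\<close> in that ring;
  in particular it requires both sides to lie in the ring.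
\<close>

definition rat_cong :: "nat \<Rightarrow> nat \<Rightarrow> rat \<Rightarrow> rat \<Rightarrow> bool" where
  "rat_cong p a x y \<longleftrightarrow>
     x \<in> p_integral p \<and> y \<in> p_integral p \<and>
     (\<exists>z\<in>p_integral p. x - y = of_nat p ^ a * z)"

end

(*
Let p = 2 n + 1. Modulo p, the number binomial(2k, k) / 2^k is (-2)^k binomial(n, k), so the sum in
question reduces to F = sum_k (-2)^k binomial(n, k) H2_k, which induction on n evaluates exactly:

  (-1)^n F = (A^2 + H2) / 2 - T - A2,

where A = sum (-1)^i / i, A2 = sum (-1)^i / i^2, H = sum 1 / i, H2 = sum 1 / i^2 for i = 1..n, and
T = sum_{m <= n} (-1)^m / m * (1 + 1/2 + ... + 1/(m - 1)). With the Fermat quotient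
Q = (2^(p - 1) - 1) / p, one has modulo p^2

  Q = - A + p T,    2 A + p A2 = H,    H = - 2 Q + p Q^2,

and H2 = 0 modulo p. Eliminating H gives A2 = Q^2 - 2 T modulo p, while A^2 = Q^2; hence
(-1)^n F = - A2 / 2. On the other side, the Euler number E_m is congruent to
(-1)^n times the sum of (-1)^j (2 j)^m over |j| <= n, which for m = p - 3 is (-1)^n A2 / 2
by Fermat's little theorem.
*)

theory Submission
  imports Defs "HOL-Number_Theory.Residues"
begin

section \<open>The ring of p-integral rationals\<close>

text \<open>The reduced denominator divides every other denominator, so membership can be witnessed
  by any fraction, reduced or not.\<close>

lemma p_integral_iff:
  assumes "prime p"
  shows "x \<in> p_integral p \<longleftrightarrow> (\<exists>a b. \<not> int p dvd b \<and> x = of_int a / of_int b)"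
proof
  assume "x \<in> p_integral p"
  moreover obtain a b where q: "quotient_of x = (a, b)"
    by fastforce
  ultimately show "\<exists>a b. \<not> int p dvd b \<and> x = of_int a / of_int b"
    using quotient_of_div [OF q] by (auto simp: p_integral_def)
next
  assume "\<exists>a b. \<not> int p dvd b \<and> x = of_int a / of_int b"
  then obtain a b where b: "\<not> int p dvd b" and x: "x = of_int a / of_int b"
    by blast
  obtain c d where q: "quotient_of x = (c, d)"
    by fastforce
  have d: "d > 0" and cop: "coprime c d" and x': "x = of_int c / of_int d"
    using quotient_of_denom_pos [OF q] quotient_of_coprime [OF q] quotient_of_div [OF q] by auto
  have "b \<noteq> 0"
    using b by auto
  then have "(of_int (c * b) :: rat) = of_int (a * d)"
    using x x' d by (simp add: field_simps)
  then have "c * b = a * d"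
    by (simp only: of_int_eq_iff)
  then have "d dvd c * b"
    by simp
  then have "d dvd b"
    using cop coprime_commute coprime_dvd_mult_right_iff by blast
  then have "\<not> int p dvd d"
    using b dvd_trans by blast
  then show "x \<in> p_integral p"
    by (simp add: p_integral_def q)
qed

lemma p_integralI:
  "prime p \<Longrightarrow> \<not> int p dvd b \<Longrightarrow> x = of_int a / of_int b \<Longrightarrow> x \<in> p_integral p"
  using p_integral_iff by blast

lemma p_integral_of_int: "prime p \<Longrightarrow> of_int a \<in> p_integral p"
  by (rule p_integralI [of p 1 _ a]) (auto dest: not_prime_unit)

lemma p_integral_of_nat: "prime p \<Longrightarrow> of_nat a \<in> p_integral p"
  using p_integral_of_int [of p "int a"] by simp

lemma p_integral_numeral:
  assumes "prime p"
  shows "0 \<in> p_integral p" "1 \<in> p_integral p" "numeral w \<in> p_integral p"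
  using p_integral_of_int [OF assms, of 0] p_integral_of_int [OF assms, of 1]
    p_integral_of_int [OF assms, of "numeral w"] by simp_all

lemma p_integral_mult:
  assumes "prime p" "x \<in> p_integral p" "y \<in> p_integral p"
  shows "x * y \<in> p_integral p"
proof -
  from assms obtain a b c d where "\<not> int p dvd b" "x = of_int a / of_int b"
    "\<not> int p dvd d" "y = of_int c / of_int d"
    by (metis p_integral_iff)
  moreover from this have "\<not> int p dvd b * d"
    using assms(1) by (simp add: prime_dvd_mult_iff)
  ultimately show ?thesis
    using assms(1) by (intro p_integralI [of p "b * d" _ "a * c"]) simp_all
qed

lemma p_integral_add:
  assumes "prime p" "x \<in> p_integral p" "y \<in> p_integral p"
  shows "x + y \<in> p_integral p"
proof -
  from assms obtain a b c d where *: "\<not> int p dvd b" "x = of_int a / of_int b"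
    "\<not> int p dvd d" "y = of_int c / of_int d"
    by (metis p_integral_iff)
  moreover from this have "\<not> int p dvd b * d"
    using assms(1) by (simp add: prime_dvd_mult_iff)
  moreover have "b \<noteq> 0" "d \<noteq> 0"
    using * by auto
  ultimately show ?thesis
    using assms(1)
    by (intro p_integralI [of p "b * d" _ "a * d + c * b"]) (simp_all add: field_simps)
qed

lemma p_integral_uminus: "prime p \<Longrightarrow> x \<in> p_integral p \<Longrightarrow> - x \<in> p_integral p"
  using p_integral_mult [of p "- 1" x] p_integral_of_int [of p "- 1"] by simp

lemma p_integral_diff:
  "prime p \<Longrightarrow> x \<in> p_integral p \<Longrightarrow> y \<in> p_integral p \<Longrightarrow> x - y \<in> p_integral p"
  using p_integral_add [of p x "- y"] p_integral_uminus [of p y] by simp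

lemma p_integral_power: "prime p \<Longrightarrow> x \<in> p_integral p \<Longrightarrow> x ^ k \<in> p_integral p"
  by (induction k) (auto intro: p_integral_mult p_integral_numeral)

lemma p_integral_sum:
  "prime p \<Longrightarrow> (\<And>i. i \<in> S \<Longrightarrow> f i \<in> p_integral p) \<Longrightarrow> sum f S \<in> p_integral p"
  by (induction S rule: infinite_finite_induct) (auto intro: p_integral_add p_integral_numeral)

lemma p_integral_divide_of_nat:
  assumes "prime p" "x \<in> p_integral p" "\<not> p dvd k"
  shows "x / of_nat k \<in> p_integral p"
proof -
  have "1 / of_nat k \<in> p_integral p"
    using assms by (intro p_integralI [of p "int k" _ 1]) simp_all
  then show ?thesis
    using p_integral_mult [OF assms(1,2), of "1 / of_nat k"] by simp
qed

lemma p_integral_divide_of_nat_power: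
  assumes "prime p" "x \<in> p_integral p" "\<not> p dvd k"
  shows "x / of_nat k ^ a \<in> p_integral p"
proof -
  have "\<not> p dvd k ^ a"
    using assms(1,3) by (auto dest: prime_dvd_power)
  then show ?thesis
    using p_integral_divide_of_nat [OF assms(1,2), of "k ^ a"] by simp
qed

lemma p_integral_divide_power_two:
  assumes "prime p" "odd p" "x \<in> p_integral p"
  shows "x / 2 ^ a \<in> p_integral p"
proof -
  have "\<not> p dvd 2"
    using assms(2) prime_ge_2_nat [OF assms(1)] dvd_imp_le [of p 2] by fastforce
  then show ?thesis
    using p_integral_divide_of_nat_power [OF assms(1,3), of 2] by simp
qed

lemmas p_integral_intros =
  p_integral_of_int p_integral_of_nat p_integral_numeral p_integral_mult p_integral_add
  p_integral_uminus p_integral_diff p_integral_power p_integral_sum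

section \<open>Congruences in that ring\<close>

text \<open>Integrality of \<open>x\<close> follows from that of \<open>y\<close> and
  \<open>z\<close>, so only one side has to be checked.\<close>

lemma rat_congI:
  "prime p \<Longrightarrow> y \<in> p_integral p \<Longrightarrow> z \<in> p_integral p \<Longrightarrow> x = y + of_nat p ^ a * z \<Longrightarrow> rat_cong p a x y"
  by (auto simp: rat_cong_def intro: p_integral_intros)

lemma rat_congE:
  assumes "rat_cong p a x y"
  obtains z where "z \<in> p_integral p" "x = y + of_nat p ^ a * z"
  using assms by (auto simp: rat_cong_def algebra_simps)

lemma rat_cong_integral:
  "rat_cong p a x y \<Longrightarrow> x \<in> p_integral p" "rat_cong p a x y \<Longrightarrow> y \<in> p_integral p"
  by (auto simp: rat_cong_def)

lemma rat_cong_refl: "prime p \<Longrightarrow> x \<in> p_integral p \<Longrightarrow> rat_cong p a x x"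
  by (rule rat_congI [where z = 0]) (auto intro: p_integral_intros)

lemma rat_cong_sym:
  assumes "prime p" "rat_cong p a x y"
  shows "rat_cong p a y x"
proof -
  obtain z where "z \<in> p_integral p" "x = y + of_nat p ^ a * z"
    using assms(2) by (rule rat_congE)
  then show ?thesis
    using assms(1) rat_cong_integral [OF assms(2)]
    by (intro rat_congI [where z = "- z"]) (auto intro: p_integral_intros)
qed

lemma rat_cong_add:
  assumes "prime p" "rat_cong p a x y" "rat_cong p a x' y'"
  shows "rat_cong p a (x + x') (y + y')"
proof -
  obtain z z' where "z \<in> p_integral p" "x = y + of_nat p ^ a * z"
    "z' \<in> p_integral p" "x' = y' + of_nat p ^ a * z'"
    using assms(2,3) by (meson rat_congE)
  then show ?thesis
    using assms(1) rat_cong_integral [OF assms(2)] rat_cong_integral [OF assms(3)]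
    by (intro rat_congI [where z = "z + z'"]) (auto intro: p_integral_intros simp: algebra_simps)
qed

lemma rat_cong_mult:
  assumes "prime p" "rat_cong p a x y" "rat_cong p a x' y'"
  shows "rat_cong p a (x * x') (y * y')"
proof -
  obtain z z' where "z \<in> p_integral p" "x = y + of_nat p ^ a * z"
    "z' \<in> p_integral p" "x' = y' + of_nat p ^ a * z'"
    using assms(2,3) by (meson rat_congE)
  then show ?thesis
    using assms rat_cong_integral [OF assms(2)] rat_cong_integral [OF assms(3)]
    \<comment> \<open>The witness comes from
      \<open>x * x' - y * y' = (x - y) * x' + y * (x' - y')\<close>.\<close>
    by (intro rat_congI [where z = "z * x' + z' * y"])
      (auto intro!: p_integral_intros simp: algebra_simps)
qed

text \<open>Primality is the last premise, so that a calculation matches the two congruences first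
  and leaves \<open>prime p\<close> to be discharged at the end.\<close>

lemma rat_cong_trans [trans]:
  assumes "rat_cong p a x y" "rat_cong p a y w" "prime p"
  shows "rat_cong p a x w"
proof -
  obtain z z' where "z \<in> p_integral p" "x = y + of_nat p ^ a * z"
    "z' \<in> p_integral p" "y = w + of_nat p ^ a * z'"
    using assms(1,2) by (meson rat_congE)
  then show ?thesis
    using assms(3) rat_cong_integral [OF assms(2)]
    by (intro rat_congI [where z = "z + z'"]) (auto intro: p_integral_intros simp: algebra_simps)
qed

lemma rat_cong_sum:
  assumes "prime p" "\<And>i. i \<in> S \<Longrightarrow> rat_cong p a (f i) (g i)"
  shows "rat_cong p a (sum f S) (sum g S)"
  using assms(2)
  by (induction S rule: infinite_finite_induct)
    (auto intro: rat_cong_add rat_cong_refl p_integral_numeral assms(1))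

lemma rat_cong_of_int:
  assumes "prime p" "[x = y] (mod int p)"
  shows "rat_cong p 1 (of_int x) (of_int y)"
proof -
  obtain k where "x - y = int p * k"
    using assms(2) by (auto simp: cong_iff_dvd_diff)
  then have "x = y + int p * k"
    by simp
  then show ?thesis
    using assms(1) by (intro rat_congI [where z = "of_int k"]) (auto intro: p_integral_intros)
qed

section \<open>Harmonic sums, plain and alternating\<close>

text \<open>The parameter \<open>s\<close> is 1 or -1. The sums A, A2, H, H2 of the overview are
  \<open>hsum (-1) 1 n\<close>, \<open>hsum (-1) 2 n\<close>, \<open>hsum 1 1 n\<close>,
  \<open>hsum 1 2 n\<close>.\<close>

definition hsum :: "rat \<Rightarrow> nat \<Rightarrow> nat \<Rightarrow> rat" where
  "hsum s a n = (\<Sum>i = 1..n. s ^ i / of_nat i ^ a)"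

lemma hsum_0 [simp]: "hsum s a 0 = 0"
  and hsum_Suc [simp]: "hsum s a (Suc n) = hsum s a n + s ^ Suc n / of_nat (Suc n) ^ a"
  by (simp_all add: hsum_def)

lemma harm2_eq_hsum: "harm2 n = hsum 1 2 n"
  by (auto simp: harm2_def hsum_def intro!: sum.cong)

lemma p_integral_hsum:
  assumes "prime p" "s \<in> p_integral p" "n < p"
  shows "hsum s a n \<in> p_integral p"
  unfolding hsum_def using assms
  by (auto intro!: p_integral_intros p_integral_divide_of_nat_power dest: dvd_imp_le)

section \<open>Exact evaluation of binomial sums\<close>

text \<open>Pascal's rule, with \<open>a (Suc k)\<close> split as \<open>a k\<close> plus a
  difference. At \<open>x = -2\<close> the factor \<open>1 + x\<close> is -1, so the old sum only
  changes sign.\<close>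

lemma binomial_sum_Suc:
  fixes x :: "'a :: comm_ring_1"
  shows "(\<Sum>k\<le>Suc n. of_nat (Suc n choose k) * x ^ k * a k) =
    (1 + x) * (\<Sum>k\<le>n. of_nat (n choose k) * x ^ k * a k) +
    (\<Sum>k\<le>n. of_nat (n choose k) * x ^ Suc k * (a (Suc k) - a k))"
proof -
  have "(\<Sum>k\<le>Suc n. of_nat (Suc n choose k) * x ^ k * a k) =
      a 0 + (\<Sum>k\<le>n. of_nat (n choose Suc k) * x ^ Suc k * a (Suc k)) +
      (\<Sum>k\<le>n. of_nat (n choose k) * x ^ Suc k * a (Suc k))"
    by (subst sum.atMost_Suc_shift) (simp add: sum.distrib algebra_simps)
  also have "a 0 + (\<Sum>k\<le>n. of_nat (n choose Suc k) * x ^ Suc k * a (Suc k)) =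
      (\<Sum>k\<le>Suc n. of_nat (n choose k) * x ^ k * a k)"
    by (subst sum.atMost_Suc_shift) simp
  also have "\<dots> = (\<Sum>k\<le>n. of_nat (n choose k) * x ^ k * a k)"
    by (simp add: binomial_eq_0)
  finally show ?thesis
    by (simp add: sum_distrib_left sum.distrib sum_subtractf algebra_simps)
qed

lemma binomial_absorb_Suc:
  "of_nat (n choose k) / of_nat (Suc k) = (of_nat (Suc n choose Suc k) / of_nat (Suc n) :: rat)"
proof -
  have "(of_nat (Suc n * (n choose k)) :: rat) = of_nat ((Suc n choose Suc k) * Suc k)"
    by (simp only: Suc_times_binomial_eq)
  then show ?thesis
    by (subst frac_eq_eq)
      (simp_all only: of_nat_mult of_nat_eq_0_iff nat.distinct not_False_eq_True mult.commute)
qed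

text \<open>The term at \<open>k = 0\<close> vanishes because \<open>1 / 0 = 0\<close>.\<close>

lemma binomial_sum_inverse:
  "(\<Sum>k\<le>n. of_nat (n choose k) * (-2) ^ k * (1 / of_nat k)) = hsum (-1) 1 n - hsum 1 1 n"
proof (induction n)
  case (Suc n)
  have step: "(\<Sum>k\<le>n. of_nat (n choose k) * (-2) ^ Suc k * (1 / of_nat (Suc k))) =
      ((-1) ^ Suc n - 1) / (of_nat (Suc n) :: rat)"
  proof -
    have "(\<Sum>k\<le>n. of_nat (n choose k) * (-2) ^ Suc k * (1 / of_nat (Suc k))) =
        (\<Sum>k\<le>n. of_nat (Suc n choose Suc k) * (-2) ^ Suc k) / (of_nat (Suc n) :: rat)"
      unfolding sum_divide_distrib
    proof (intro sum.cong refl)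
      fix k
      have "of_nat (n choose k) * (-2) ^ Suc k * (1 / of_nat (Suc k)) =
          of_nat (n choose k) / of_nat (Suc k) * (-2 :: rat) ^ Suc k"
        by simp
      then show "of_nat (n choose k) * (-2) ^ Suc k * (1 / of_nat (Suc k)) =
          of_nat (Suc n choose Suc k) * (-2) ^ Suc k / (of_nat (Suc n) :: rat)"
        unfolding binomial_absorb_Suc by simp
    qed
    also have "(\<Sum>k\<le>n. of_nat (Suc n choose Suc k) * (-2) ^ Suc k) =
        (\<Sum>k\<le>Suc n. of_nat (Suc n choose k) * (-2 :: rat) ^ k) - 1"
      by (subst sum.atMost_Suc_shift) simp
    also have "(\<Sum>k\<le>Suc n. of_nat (Suc n choose k) * (-2 :: rat) ^ k) = (-2 + 1) ^ Suc n"
      by (subst binomial_ring) simp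
    finally show ?thesis
      by simp
  qed
  \<comment> \<open>If S is the old sum, \<open>1 + x = -1\<close> contributes -S and the subtracted
    \<open>a k\<close> contribute 2 S, so S itself remains.\<close>
  have "(\<Sum>k\<le>Suc n. of_nat (Suc n choose k) * (-2) ^ k * (1 / of_nat k)) =
      (\<Sum>k\<le>n. of_nat (n choose k) * (-2) ^ k * (1 / of_nat k)) +
      (\<Sum>k\<le>n. of_nat (n choose k) * (-2) ^ Suc k * (1 / of_nat (Suc k)) :: rat)"
    unfolding binomial_sum_Suc by (simp add: sum_subtractf sum_negf sum_distrib_left algebra_simps)
  then show ?case
    unfolding step Suc by (simp add: diff_divide_distrib)
qed simp

text \<open>The sign (-1)^n cancels the sign change in \<open>binomial_sum_Suc\<close>. By
  \<open>binomial_sum_inverse\<close> the left side then grows at each m by (-1)^m / m times the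
  difference of the alternating and the plain harmonic sum up to m. Summed over m, the alternating
  part gives (A^2 + H2) / 2 by symmetry, the plain part T + A2.\<close>

lemma binomial_sum_harm2:
  "(-1) ^ n * (\<Sum>k\<le>n. of_nat (n choose k) * (-2) ^ k * hsum 1 2 k) =
    ((hsum (-1) 1 n)\<^sup>2 + hsum 1 2 n) / 2
    - (\<Sum>m = 1..n. (-1) ^ m / of_nat m * hsum 1 1 (m - 1)) - hsum (-1) 2 n"
proof (induction n)
  case (Suc n)
  let ?e = "(-1 :: rat) ^ Suc n" and ?N = "of_nat (Suc n) :: rat"
  have e: "?e * ?e = 1"
    by (simp flip: power_add)
  \<comment> \<open>One increment of the closed form, with \<open>e\<close> for (-1)^(n + 1) and
    \<open>r\<close> for 1 / (n + 1). The correction term with \<open>1 - e * e\<close> makes it a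
    polynomial identity.\<close>
  have step: "((A + e * r)\<^sup>2 + (H2 + r\<^sup>2)) / 2 - (T + e * r * H) - (A2 + e * r\<^sup>2) =
      (A\<^sup>2 + H2) / 2 - T - A2 + e * r * ((A + e * r) - (H + r))"
    if "e * e = 1" for A H2 T H A2 e r :: rat
  proof -
    have "((A + e * r)\<^sup>2 + (H2 + r\<^sup>2)) / 2 - (T + e * r * H) - (A2 + e * r\<^sup>2) =
        (A\<^sup>2 + H2) / 2 - T - A2 + e * r * ((A + e * r) - (H + r)) + (1 - e * e) * r\<^sup>2 / 2"
      by (simp add: field_simps power2_eq_square)
    then show ?thesis
      using that by simp
  qed
  have "(\<Sum>k\<le>n. of_nat (n choose k) * (-2) ^ Suc k * (hsum 1 2 (Suc k) - hsum 1 2 k)) =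
      (\<Sum>k\<le>n. of_nat (Suc n choose Suc k) * (-2) ^ Suc k * (1 / of_nat (Suc k))) / ?N"
    unfolding sum_divide_distrib
  proof (intro sum.cong refl)
    fix k
    have "of_nat (n choose k) * (-2) ^ Suc k * (hsum 1 2 (Suc k) - hsum 1 2 k) =
        of_nat (n choose k) / of_nat (Suc k) * ((-2) ^ Suc k * (1 / of_nat (Suc k)))"
      by (simp add: power2_eq_square)
    then show "of_nat (n choose k) * (-2) ^ Suc k * (hsum 1 2 (Suc k) - hsum 1 2 k) =
        of_nat (Suc n choose Suc k) * (-2) ^ Suc k * (1 / of_nat (Suc k)) / ?N"
      unfolding binomial_absorb_Suc by (simp add: mult.assoc)
  qed
  also have "(\<Sum>k\<le>n. of_nat (Suc n choose Suc k) * (-2) ^ Suc k * (1 / of_nat (Suc k))) =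
      (\<Sum>k\<le>Suc n. of_nat (Suc n choose k) * (-2) ^ k * (1 / of_nat k) :: rat)"
    by (subst sum.atMost_Suc_shift) simp
  finally have "(\<Sum>k\<le>Suc n. of_nat (Suc n choose k) * (-2) ^ k * hsum 1 2 k) =
      - (\<Sum>k\<le>n. of_nat (n choose k) * (-2) ^ k * hsum 1 2 k) +
      (hsum (-1) 1 (Suc n) - hsum 1 1 (Suc n)) / ?N"
    unfolding binomial_sum_inverse by (subst binomial_sum_Suc) simp
  then have "?e * (\<Sum>k\<le>Suc n. of_nat (Suc n choose k) * (-2) ^ k * hsum 1 2 k) =
      (-1) ^ n * (\<Sum>k\<le>n. of_nat (n choose k) * (-2) ^ k * hsum 1 2 k) +
      ?e / ?N * (hsum (-1) 1 (Suc n) - hsum 1 1 (Suc n))"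
    by (simp only: distrib_left) simp
  then show ?case
    unfolding Suc using step [OF e, of "hsum (-1) 1 n" "1 / ?N" "hsum 1 2 n" _ "hsum 1 1 n" "hsum (-1) 2 n"]
    by (simp add: power_divide)
qed simp

section \<open>Binomial coefficients as products, and central ones modulo p\<close>

text \<open>The difference is taken among the rationals, so that the identity also covers
  \<open>k > n\<close>.\<close>

lemma binomial_Suc_right:
  "of_nat (Suc k) * of_nat (n choose Suc k) = (of_nat n - of_nat k) * (of_nat (n choose k) :: rat)"
  using gbinomial_mult_1 [of "of_nat n :: rat" k] by (simp add: binomial_gbinomial algebra_simps)

text \<open>For \<open>n = p - 1\<close> each factor becomes 1 - p / j, ready for expansion in
  powers of p.\<close>

lemma binomial_eq_prod:
  "of_nat (n choose k) = (-1) ^ k * (\<Prod>j = 1..k. 1 - of_nat (Suc n) / of_nat j :: rat)"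
proof (induction k)
  case (Suc k)
  have "of_nat (n choose Suc k) = (of_nat n - of_nat k) / of_nat (Suc k) * (of_nat (n choose k) :: rat)"
    using binomial_Suc_right [of k n] by (simp add: field_simps del: of_nat_Suc)
  also have "(of_nat n - of_nat k) / of_nat (Suc k) = - (1 - of_nat (Suc n) / of_nat (Suc k) :: rat)"
    by (simp add: field_simps)
  finally show ?case
    unfolding Suc by (simp add: algebra_simps del: of_nat_Suc)
qed simp

lemma central_binomial_Suc:
  "of_nat (Suc k) * of_nat ((2 * Suc k) choose Suc k) =
    2 * of_nat (2 * k + 1) * (of_nat ((2 * k) choose k) :: rat)"
proof -
  have "Suc k * ((2 * Suc k) choose Suc k) = 2 * (Suc k * (Suc (2 * k) choose k))"
    using Suc_times_binomial_eq [of "Suc (2 * k)" k] by (simp add: mult.commute)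
  also have "Suc (2 * k) choose k = Suc (2 * k) choose Suc k"
    using binomial_symmetric [of k "Suc (2 * k)"] by simp
  also have "Suc k * (Suc (2 * k) choose Suc k) = Suc (2 * k) * ((2 * k) choose k)"
    using Suc_times_binomial_eq [of "2 * k" k] by (simp only: mult.commute)
  finally have "of_nat (Suc k * ((2 * Suc k) choose Suc k)) =
      (of_nat (2 * (Suc (2 * k) * ((2 * k) choose k))) :: rat)"
    by (simp only:)
  then show ?thesis
    by (simp only: of_nat_mult of_nat_numeral mult.assoc Suc_eq_plus1)
qed

text \<open>From k to k + 1 the left side is multiplied by (2 k + 1) / (k + 1), the right side by -2
  (n - k) / (k + 1) = (2 k + 1 - p) / (k + 1).\<close>

lemma central_binomial_cong:
  assumes p: "prime p" "p = 2 * n + 1" and "k < p"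
  shows "rat_cong p 1 (of_nat ((2 * k) choose k) / 2 ^ k) (of_nat (n choose k) * (-2) ^ k)"
  using \<open>k < p\<close>
proof (induction k)
  case 0
  then show ?case
    using p by (simp add: rat_cong_refl p_integral_numeral)
next
  case (Suc k)
  have k: "\<not> p dvd Suc k"
    using Suc.prems by (auto dest: dvd_imp_le)
  have "rat_cong p 1 (of_nat (2 * k + 1)) (of_nat (2 * k + 1) - of_nat p)"
    using p(1) by (intro rat_congI [where z = 1] p_integral_intros) simp_all
  then have "rat_cong p 1 (of_nat ((2 * k) choose k) / 2 ^ k * of_nat (2 * k + 1) * (1 / of_nat (Suc k)))
      (of_nat (n choose k) * (-2) ^ k * (of_nat (2 * k + 1) - of_nat p) * (1 / of_nat (Suc k)))"
    using Suc p(1) k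
    by (intro rat_cong_mult rat_cong_refl p_integral_divide_of_nat p_integral_intros) simp_all
  also have "of_nat ((2 * k) choose k) / 2 ^ k * of_nat (2 * k + 1) * (1 / of_nat (Suc k)) =
      of_nat ((2 * Suc k) choose Suc k) / (2 ^ Suc k :: rat)"
    using central_binomial_Suc [of k] by (simp add: field_simps del: of_nat_Suc mult_Suc_right)
  also have "of_nat (n choose k) * (-2) ^ k * (of_nat (2 * k + 1) - of_nat p) * (1 / of_nat (Suc k)) =
      (of_nat (n choose Suc k) * (-2) ^ Suc k :: rat)"
  proof -
    have "of_nat (2 * k + 1) - of_nat p = (-2) * (of_nat n - of_nat k :: rat)"
      by (simp add: p)
    then have "of_nat (n choose k) * (-2) ^ k * (of_nat (2 * k + 1) - of_nat p) * (1 / of_nat (Suc k)) =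
        (-2) ^ Suc k * ((of_nat n - of_nat k) * of_nat (n choose k)) / (of_nat (Suc k) :: rat)"
      by (simp only: power_Suc times_divide_eq_left times_divide_eq_right mult_1_left mult_1_right ac_simps)
    then show ?thesis
      unfolding binomial_Suc_right [symmetric] by (simp del: of_nat_Suc)
  qed
  finally show ?case .
qed

section \<open>Expansion of products modulo p^3\<close>

text \<open>The coefficients are the elementary symmetric functions of the 1 / j, the second one
  expressed by power sums. The cases \<open>c = 1\<close> and \<open>c = 1 / 2\<close> are used
  later.\<close>

lemma prod_expansion:
  assumes p: "prime p" "odd p" and c: "c \<in> p_integral p" and "k < p"
  shows "rat_cong p 3 (\<Prod>j = 1..k. 1 - of_nat p * c / of_nat j)
    (1 - of_nat p * c * hsum 1 1 k +
      of_nat p ^ 2 * c\<^sup>2 * (((hsum 1 1 k)\<^sup>2 - hsum 1 2 k) / 2))"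
  using \<open>k < p\<close>
proof (induction k)
  case 0
  then show ?case
    using p by (simp add: rat_cong_refl p_integral_numeral)
next
  case (Suc k)
  define P H H2 r :: rat where "P = of_nat p" and "H = hsum 1 1 k" and "H2 = hsum 1 2 k"
    and "r = 1 / of_nat (Suc k)"
  define D where "D = (H\<^sup>2 - H2) / 2"
  have "rat_cong p 3 (\<Prod>j = 1..k. 1 - P * c / of_nat j) (1 - P * c * H + P ^ 2 * c\<^sup>2 * D)"
    unfolding P_def H_def H2_def D_def using Suc by simp
  then obtain z where z: "z \<in> p_integral p" and
    eq: "(\<Prod>j = 1..k. 1 - P * c / of_nat j) = 1 - P * c * H + P ^ 2 * c\<^sup>2 * D + P ^ 3 * z"
    unfolding P_def by (rule rat_congE)
  have r: "r \<in> p_integral p"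
    unfolding r_def using p Suc.prems
    by (intro p_integral_divide_of_nat p_integral_intros) (auto dest: dvd_imp_le)
  have P: "P \<in> p_integral p" and H: "H \<in> p_integral p"
    unfolding P_def H_def using p Suc.prems
    by (simp_all add: p_integral_hsum p_integral_of_nat p_integral_numeral)
  have D: "D \<in> p_integral p"
    unfolding D_def H_def H2_def using p Suc.prems p_integral_divide_power_two [of p _ 1]
    by (simp add: p_integral_diff p_integral_power p_integral_hsum p_integral_numeral)
  have "hsum 1 2 (Suc k) = H2 + r\<^sup>2" and hs1: "hsum 1 1 (Suc k) = H + r"
    by (simp_all add: H_def H2_def r_def power_divide)
  then have hs2: "((H + r)\<^sup>2 - hsum 1 2 (Suc k)) / 2 = D + H * r"
    by (simp only:) (simp add: D_def field_simps power2_eq_square)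
  have "(\<Prod>j = 1..Suc k. 1 - P * c / of_nat j) = (\<Prod>j = 1..k. 1 - P * c / of_nat j) * (1 - P * c * r)"
    by (simp add: r_def)
  \<comment> \<open>The second symmetric function becomes \<open>D + H * r\<close>; everything of
    order \<open>P ^ 3\<close> goes into the witness.\<close>
  also have "\<dots> = 1 - P * c * (H + r) + P ^ 2 * c\<^sup>2 * (D + H * r) +
      P ^ 3 * (z * (1 - P * c * r) - c ^ 3 * r * D)"
    unfolding eq by (simp add: algebra_simps power2_eq_square power3_eq_cube)
  finally show ?case
    unfolding hs1 hs2 P_def [symmetric] using p(1) P H D r z c
    by (intro rat_congI [where z = "z * (1 - P * c * r) - c ^ 3 * r * D"] p_integral_intros)
      (simp_all add: P_def)
qed

section \<open>Two ways of pairing 1, ..., 2 n\<close>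

context comm_monoid_set
begin

text \<open>Stated for a commutative monoid because both sums and products are paired in this
  way.\<close>

lemma split_reflect:
  "F g {1..2 * n} = F (\<lambda>j. g j \<^bold>* g (2 * n + 1 - j)) {1..n :: nat}"
proof -
  have "F g {1..2 * n} = F g ({1..n} \<union> {n + 1..2 * n})"
    by (rule arg_cong [where f = "F g"]) auto
  also have "\<dots> = F g {1..n} \<^bold>* F g {n + 1..2 * n}"
    by (rule union_disjoint) auto
  also have "F g {n + 1..2 * n} = F (\<lambda>j. g (2 * n + 1 - j)) {1..n}"
    by (rule reindex_bij_witness [where i = "\<lambda>j. 2 * n + 1 - j" and j = "\<lambda>j. 2 * n + 1 - j"]) auto
  finally show ?thesis
    by (simp add: distrib)
qed

text \<open>As 2 n + 1 is odd, reflection exchanges even and odd numbers; the odd ones are thus the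
  reflected even ones.\<close>

lemma split_parity:
  "F g {1..2 * n} = F (\<lambda>j. g (2 * j) \<^bold>* g (2 * n + 1 - 2 * j)) {1..n :: nat}"
proof -
  have "F g {1..2 * n} = F g ({k \<in> {1..2 * n}. even k} \<union> {k \<in> {1..2 * n}. odd k})"
    by (rule arg_cong [where f = "F g"]) auto
  also have "\<dots> = F g {k \<in> {1..2 * n}. even k} \<^bold>* F g {k \<in> {1..2 * n}. odd k}"
    by (rule union_disjoint) auto
  also have "F g {k \<in> {1..2 * n}. even k} = F (\<lambda>j. g (2 * j)) {1..n}"
    by (rule reindex_bij_witness [where i = "\<lambda>j. 2 * j" and j = "\<lambda>j. j div 2"]) auto
  also have "F g {k \<in> {1..2 * n}. odd k} = F (\<lambda>j. g (2 * n + 1 - 2 * j)) {1..n}"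
    by (rule reindex_bij_witness
        [where i = "\<lambda>j. 2 * n + 1 - 2 * j" and j = "\<lambda>k. n - k div 2"])
      (auto elim!: oddE intro!: arg_cong [where f = g])
  finally show ?thesis
    by (simp add: distrib)
qed

end

section \<open>Harmonic sums and the Fermat quotient\<close>

text \<open>
  Since \<open>p\<close> is odd, \<open>2 ^ (p - 1)\<close> is the sum of the binomial coefficients \<open>p choose m\<close> with \<open>m \<le> n\<close>.
\<close>

lemma fermat_quotient_cong:
  assumes p: "prime p" "p = 2 * n + 1"
  shows "rat_cong p 2 ((2 ^ (p - 1) - 1) / of_nat p)
    (of_nat p * (\<Sum>m = 1..n. (-1) ^ m / of_nat m * hsum 1 1 (m - 1)) - hsum (-1) 1 n)"
proof -
  have p0: "of_nat p \<noteq> (0 :: rat)"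
    using p by simp
  have "rat_cong p 2 (of_nat (p choose m) / of_nat p)
      (of_nat p * ((-1) ^ m / of_nat m * hsum 1 1 (m - 1)) - (-1) ^ m / of_nat m ^ 1)"
    if "m \<in> {1..n}" for m
  proof -
    obtain k where m: "m = Suc k" and k: "Suc k < p"
      using \<open>m \<in> {1..n}\<close> p by (cases m) auto
    have ndvd: "\<not> p dvd m"
      using k m by (auto dest: dvd_imp_le)
    have hsum: "hsum 1 a k \<in> p_integral p" for a
      using p k by (intro p_integral_hsum p_integral_intros) auto
    obtain z where z: "z \<in> p_integral p" and
      prod: "(\<Prod>j = 1..k. 1 - of_nat p / of_nat j) = 1 - of_nat p * hsum 1 1 k
        + of_nat p ^ 2 * (((hsum 1 1 k)\<^sup>2 - hsum 1 2 k) / 2) + of_nat p ^ 3 * z"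
      using rat_congE [OF prod_expansion [of p 1 k]] p k by (auto intro: p_integral_intros)
    define D where "D = ((hsum 1 1 k)\<^sup>2 - hsum 1 2 k) / 2"
    have D: "D \<in> p_integral p"
      unfolding D_def using p hsum p_integral_divide_power_two [of p _ 1]
      by (simp add: p_integral_diff p_integral_power)
    \<comment> \<open>Absorption removes the factor p from \<open>p choose m\<close>; of the
      expanded product only the terms up to first order in p then matter.\<close>
    have "of_nat (p choose m) / of_nat p = of_nat (p - 1 choose k) / (of_nat m :: rat)"
      using binomial_absorb_Suc [of "p - 1" k] p by (simp add: m del: of_nat_Suc)
    also have "of_nat (p - 1 choose k) = (-1) ^ k * (\<Prod>j = 1..k. 1 - of_nat p / of_nat j :: rat)"
      using binomial_eq_prod [of "p - 1" k] p by simp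
    also have "\<dots> / of_nat m = of_nat p * ((-1) ^ m / of_nat m * hsum 1 1 (m - 1)) -
        (-1) ^ m / of_nat m ^ 1 + of_nat p ^ 2 * ((-1) ^ k * (D + of_nat p * z) / of_nat m)"
      unfolding prod D_def [symmetric]
      by (simp add: m add_divide_distrib diff_divide_distrib algebra_simps power2_eq_square
          power3_eq_cube del: of_nat_Suc)
    finally show ?thesis
      using p(1) hsum D z ndvd
      by (intro rat_congI [where z = "(-1) ^ k * (D + of_nat p * z) / of_nat m"]
          p_integral_intros p_integral_divide_of_nat p_integral_divide_of_nat_power) (simp_all add: m)
  qed
  then have "rat_cong p 2 (\<Sum>m = 1..n. of_nat (p choose m) / of_nat p)
      (\<Sum>m = 1..n. of_nat p * ((-1) ^ m / of_nat m * hsum 1 1 (m - 1)) - (-1) ^ m / of_nat m ^ 1)"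
    by (rule rat_cong_sum [OF p(1)])
  also have "(\<Sum>m = 1..n. of_nat (p choose m) / of_nat p) = (2 ^ (p - 1) - 1) / (of_nat p :: rat)"
  proof -
    have "(\<Sum>m\<le>n. p choose m) = 1 + (\<Sum>m = 1..n. p choose m)"
      unfolding atMost_atLeast0 by (subst sum.atLeast_Suc_atMost) simp_all
    then have "1 + (\<Sum>m = 1..n. p choose m) = 2 ^ (p - 1)"
      using binomial_r_part_sum [of n] p by simp
    then have "of_nat (1 + (\<Sum>m = 1..n. p choose m)) = (of_nat (2 ^ (p - 1)) :: rat)"
      by (simp only:)
    then have "(\<Sum>m = 1..n. of_nat (p choose m)) = (2 ^ (p - 1) - 1 :: rat)"
      by (simp add: algebra_simps)
    then show ?thesis
      by (simp flip: sum_divide_distrib)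
  qed
  also have "(\<Sum>m = 1..n. of_nat p * ((-1) ^ m / of_nat m * hsum 1 1 (m - 1)) - (-1) ^ m / of_nat m ^ 1) =
      of_nat p * (\<Sum>m = 1..n. (-1) ^ m / of_nat m * hsum 1 1 (m - 1)) - hsum (-1) 1 n"
    unfolding hsum_def [of "-1"] by (simp only: sum_subtractf sum_distrib_left)
  finally show ?thesis .
qed

lemma inverse_square_reflect:
  assumes "prime p" "0 < i" "i < p"
  shows "rat_cong p 1 (1 / of_nat (p - i) ^ 2) (1 / of_nat i ^ 2)"
proof -
  define x y P :: rat where "x = of_nat i" and "y = of_nat (p - i)" and "P = of_nat p"
  have "x \<noteq> 0" "y \<noteq> 0" and xy: "P = x + y"
    using assms by (auto simp: x_def y_def P_def)
  then have "1 / y ^ 2 = 1 / x ^ 2 + P ^ 1 * ((x - y) / x ^ 2 / y ^ 2)"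
    by (simp add: field_simps power2_eq_square)
  moreover have "\<not> p dvd i" "\<not> p dvd p - i"
    using assms by (auto dest: dvd_imp_le)
  ultimately show ?thesis
    using assms(1) unfolding x_def y_def P_def
    by (intro rat_congI [where z = "(of_nat i - of_nat (p - i)) / of_nat i ^ 2 / of_nat (p - i) ^ 2"]
        p_integral_divide_of_nat_power p_integral_intros)
qed

text \<open>Reflection evaluates the sum of 1 / k^2 over 0 < k < p as 2 H2, parity as H2 / 2. So 3
  H2 / 2 vanishes modulo p, and 3 is invertible because \<open>p > 3\<close>.\<close>

lemma hsum_2_cong_0:
  assumes p: "prime p" "p = 2 * n + 1" "p > 3"
  shows "rat_cong p 1 (hsum 1 2 n) 0"
proof -
  have n3: "\<not> p dvd 3"
    using p by (auto dest: dvd_imp_le)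
  let ?S = "\<Sum>k = 1..2 * n. 1 / of_nat k ^ 2 :: rat"
  have ndvd: "\<not> p dvd k" if "0 < k" "k < p" for k
    using that by (auto dest: dvd_imp_le)
  have "rat_cong p 1 ?S (\<Sum>j = 1..n. 1 / of_nat j ^ 2 + 1 / of_nat j ^ 2)"
    unfolding sum.split_reflect p(2) [symmetric] using p
    by (intro rat_cong_sum rat_cong_add rat_cong_refl inverse_square_reflect
        p_integral_divide_of_nat_power p_integral_intros ndvd) auto
  also have "(\<Sum>j = 1..n. 1 / of_nat j ^ 2 + 1 / of_nat j ^ 2) = 2 * hsum 1 2 n"
    by (simp only: hsum_def sum.distrib power_one mult_2)
  finally have 1: "rat_cong p 1 (2 * hsum 1 2 n) ?S"
    by (rule rat_cong_sym [OF p(1)])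
  have "rat_cong p 1 ?S (\<Sum>j = 1..n. 1 / of_nat (2 * j) ^ 2 + 1 / of_nat (2 * j) ^ 2)"
    unfolding sum.split_parity p(2) [symmetric] using p
    by (intro rat_cong_sum rat_cong_add rat_cong_refl inverse_square_reflect
        p_integral_divide_of_nat_power p_integral_intros ndvd) auto
  also have "(\<Sum>j = 1..n. 1 / of_nat (2 * j) ^ 2 + 1 / of_nat (2 * j) ^ 2) = hsum 1 2 n / 2"
    by (simp add: hsum_def sum_divide_distrib power2_eq_square mult_ac)
  finally have "rat_cong p 1 (2 * hsum 1 2 n) (hsum 1 2 n / 2)"
    using rat_cong_trans [OF 1] p by blast
  then obtain z where z: "z \<in> p_integral p" "2 * hsum 1 2 n = hsum 1 2 n / 2 + of_nat p ^ 1 * z"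
    by (rule rat_congE)
  have "2 * z / of_nat 3 \<in> p_integral p"
    using p z n3 by (intro p_integral_divide_of_nat p_integral_intros)
  moreover have "hsum 1 2 n = 0 + of_nat p ^ 1 * (2 * z / of_nat 3)"
    using z(2) by (simp add: field_simps)
  ultimately show ?thesis
    using p(1) p_integral_numeral(1) rat_congI by blast
qed

text \<open>Reflection turns the alternating sum of 1 / k over 0 < k < p into 2 A + p A2, while the
  corresponding plain sum becomes - p H2, which vanishes modulo p^2. By parity the two full sums add
  up to H.\<close>

lemma alternating_hsum_cong:
  assumes p: "prime p" "p = 2 * n + 1" "p > 3"
  shows "rat_cong p 2 (2 * hsum (-1) 1 n + of_nat p * hsum (-1) 2 n) (hsum 1 1 n)"
proof -
  define P :: rat where "P = of_nat p"
  define w :: "nat \<Rightarrow> rat" where "w j = 1 / of_nat j ^ 2 / of_nat (p - j)" for j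
  have w: "w j \<in> p_integral p" if "j \<in> {1..n}" for j
    unfolding w_def using that p
    by (intro p_integral_divide_of_nat p_integral_divide_of_nat_power p_integral_intros)
      (auto dest: dvd_imp_le)
  \<comment> \<open>The geometric expansion of 1 / (p - j) in powers of p, with exact remainder
    \<open>P ^ 2 * w j\<close>.\<close>
  have inv: "1 / of_nat (p - j) = P ^ 2 * w j - 1 / of_nat j - P / of_nat j ^ 2"
    if "j \<in> {1..n}" for j
  proof -
    define x y :: rat where "x = of_nat j" and "y = of_nat (p - j)"
    have "x \<noteq> 0" "y \<noteq> 0" "P = x + y"
      using that p by (auto simp: x_def y_def P_def)
    then have "1 / y = P ^ 2 * (1 / x ^ 2 / y) - 1 / x - P / x ^ 2"
      by (simp add: field_simps power2_eq_square)
    then show ?thesis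
      by (simp add: w_def x_def y_def)
  qed
  have sgn: "(-1) ^ (p - j) = - ((-1 :: rat) ^ j)" if "j \<in> {1..n}" for j
    using that p by (cases "even j") auto
  have "(\<Sum>k = 1..2 * n. (-1) ^ k / of_nat k) =
      (\<Sum>j = 1..n. (-1) ^ j / of_nat j + (-1) ^ (p - j) / of_nat (p - j) :: rat)"
    unfolding sum.split_reflect p(2) [symmetric] ..
  also have "\<dots> = (\<Sum>j = 1..n. 2 * ((-1) ^ j / of_nat j ^ 1) + P * ((-1) ^ j / of_nat j ^ 2) - P ^ 2 * ((-1) ^ j * w j))"
  proof (intro sum.cong refl)
    fix j assume j: "j \<in> {1..n}"
    have "(-1) ^ j / of_nat j + (-1) ^ (p - j) / of_nat (p - j) =
        (-1) ^ j * (1 / of_nat j - 1 / of_nat (p - j) :: rat)"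
      unfolding sgn [OF j] by (simp add: algebra_simps)
    also have "\<dots> = 2 * ((-1) ^ j / of_nat j ^ 1) + P * ((-1) ^ j / of_nat j ^ 2) - P ^ 2 * ((-1) ^ j * w j)"
      unfolding inv [OF j] by (simp add: algebra_simps)
    finally show "(-1) ^ j / of_nat j + (-1) ^ (p - j) / of_nat (p - j) =
        2 * ((-1) ^ j / of_nat j ^ 1) + P * ((-1) ^ j / of_nat j ^ 2) - P ^ 2 * ((-1) ^ j * w j)" .
  qed
  also have "\<dots> = 2 * hsum (-1) 1 n + P * hsum (-1) 2 n - P ^ 2 * (\<Sum>j = 1..n. (-1) ^ j * w j)"
    unfolding hsum_def by (simp only: sum_subtractf sum.distrib sum_distrib_left)
  finally have alt1: "(\<Sum>k = 1..2 * n. (-1) ^ k / of_nat k) =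
    2 * hsum (-1) 1 n + P * hsum (-1) 2 n - P ^ 2 * (\<Sum>j = 1..n. (-1) ^ j * w j)" .
  \<comment> \<open>Adding the plain sum cancels the odd terms and doubles the even ones.\<close>
  have "(\<Sum>k = 1..2 * n. (-1) ^ k / of_nat k) + (\<Sum>k = 1..2 * n. 1 / of_nat k) =
      (\<Sum>k = 1..2 * n. ((-1) ^ k + 1) / of_nat k :: rat)"
    by (simp add: sum.distrib add_divide_distrib)
  also have "\<dots> = (\<Sum>j = 1..n. ((-1) ^ (2 * j) + 1) / of_nat (2 * j) + ((-1) ^ (p - 2 * j) + 1) / of_nat (p - 2 * j))"
    unfolding sum.split_parity p(2) [symmetric] ..
  also have "\<dots> = hsum 1 1 n"
    unfolding hsum_def using p by (intro sum.cong refl) auto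
  finally have alt2: "(\<Sum>k = 1..2 * n. (-1) ^ k / of_nat k) + (\<Sum>k = 1..2 * n. 1 / of_nat k) = hsum 1 1 n" .
  have "(\<Sum>k = 1..2 * n. 1 / of_nat k) = (\<Sum>j = 1..n. 1 / of_nat j + 1 / of_nat (p - j) :: rat)"
    unfolding sum.split_reflect p(2) [symmetric] ..
  also have "\<dots> = (\<Sum>j = 1..n. P ^ 2 * w j - P * (1 ^ j / of_nat j ^ 2))"
    by (intro sum.cong refl) (simp add: inv)
  also have "\<dots> = P ^ 2 * (\<Sum>j = 1..n. w j) - P * hsum 1 2 n"
    unfolding hsum_def by (simp only: sum_subtractf sum_distrib_left)
  finally have full: "(\<Sum>k = 1..2 * n. 1 / of_nat k) = P ^ 2 * (\<Sum>j = 1..n. w j) - P * hsum 1 2 n" .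
  \<comment> \<open>Divisibility of H2 by p raises \<open>P * hsum 1 2 n\<close> to order
    \<open>P ^ 2\<close>.\<close>
  obtain z where z: "z \<in> p_integral p" "hsum 1 2 n = P * z"
    unfolding P_def using rat_congE [OF hsum_2_cong_0 [OF p]] by auto
  have "2 * hsum (-1) 1 n + P * hsum (-1) 2 n = hsum 1 1 n +
      P ^ 2 * (z + (\<Sum>j = 1..n. (-1) ^ j * w j) - (\<Sum>j = 1..n. w j))"
    using alt1 alt2 full z(2) by (simp add: algebra_simps power2_eq_square)
  then show ?thesis
    using p z w unfolding P_def
    by (intro rat_congI [where z = "z + (\<Sum>j = 1..n. (-1) ^ j * w j) - (\<Sum>j = 1..n. w j)"]
        p_integral_intros p_integral_hsum) auto
qed

text \<open>
  The product of \<open>1, \<dots>, p - 1\<close> can be paired as \<open>j (p - j)\<close> or as \<open>2 j (p - 2 j)\<close> for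
  \<open>1 \<le> j \<le> n\<close>. Hence \<open>\<Prod>j (1 - p / j) = 2 ^ (p - 1) * \<Prod>j (1 - p / (2 j))\<close>, and expanding both
  products modulo \<open>p ^ 3\<close> determines the harmonic sum modulo \<open>p ^ 2\<close>.
\<close>

lemma harm_cong:
  fixes n p :: nat
  defines "Q \<equiv> (2 ^ (p - 1) - 1) / of_nat p :: rat"
  assumes p: "prime p" "p = 2 * n + 1" "p > 3"
  shows "rat_cong p 2 (hsum 1 1 n) (of_nat p * Q\<^sup>2 - 2 * Q)"
proof -
  \<comment> \<open>Scaled so that the product for \<open>c = 1 / 2\<close> has coefficients
    \<open>K\<close> and \<open>E\<close>, and the one for \<open>c = 1\<close> has
    \<open>2 * K\<close> and \<open>4 * E\<close>.\<close>
  define P K E :: rat where "P = of_nat p" and "K = hsum 1 1 n / 2"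
    and "E = ((hsum 1 1 n)\<^sup>2 - hsum 1 2 n) / 2 / 4"
  have P0: "P \<noteq> 0"
    using p by (simp add: P_def)
  have odd: "odd p" and np: "n < p"
    using p by auto
  have half: "x / 2 \<in> p_integral p" if "x \<in> p_integral p" for x
    using p_integral_divide_power_two [OF p(1) odd that, of 1] by simp
  have quarter: "x / 4 \<in> p_integral p" if "x \<in> p_integral p" for x
    using p_integral_divide_power_two [OF p(1) odd that, of 2] by simp
  have hsum: "hsum 1 a n \<in> p_integral p" for a
    using p np by (intro p_integral_hsum p_integral_intros)
  have K: "K \<in> p_integral p" and E: "E \<in> p_integral p"
    unfolding K_def E_def by (intro half quarter p_integral_intros p(1) hsum)+
  have Q: "Q \<in> p_integral p"
    using rat_cong_integral(1) [OF fermat_quotient_cong [OF p(1,2)]] by (simp add: Q_def)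
  obtain z1 where z1: "z1 \<in> p_integral p"
    and "(\<Prod>j = 1..n. 1 - P * 1 / of_nat j) = 1 - P * 1 * hsum 1 1 n +
      P ^ 2 * 1\<^sup>2 * (((hsum 1 1 n)\<^sup>2 - hsum 1 2 n) / 2) + P ^ 3 * z1"
    unfolding P_def
    by (rule rat_congE [OF prod_expansion [OF p(1) odd p_integral_numeral(2) [OF p(1)] np]])
  then have eq1: "(\<Prod>j = 1..n. 1 - P / of_nat j) = 1 - 2 * P * K + 4 * P ^ 2 * E + P ^ 3 * z1"
    by (simp add: K_def E_def)
  obtain z2 where z2: "z2 \<in> p_integral p"
    and "(\<Prod>j = 1..n. 1 - P * (1 / 2) / of_nat j) = 1 - P * (1 / 2) * hsum 1 1 n +
      P ^ 2 * (1 / 2)\<^sup>2 * (((hsum 1 1 n)\<^sup>2 - hsum 1 2 n) / 2) + P ^ 3 * z2"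
    unfolding P_def
    by (rule rat_congE [OF prod_expansion [OF p(1) odd half [OF p_integral_numeral(2) [OF p(1)]] np]])
  then have eq2: "(\<Prod>j = 1..n. 1 - P / of_nat (2 * j)) = 1 - P * K + P ^ 2 * E + P ^ 3 * z2"
    by (simp add: K_def E_def power2_eq_square)
  have "(\<Prod>j = 1..n. of_nat j * of_nat (p - j)) =
      (\<Prod>j = 1..n. of_nat (2 * j) * of_nat (p - 2 * j) :: rat)"
    using prod.split_reflect [of "of_nat :: nat \<Rightarrow> rat" n] prod.split_parity [of "of_nat :: nat \<Rightarrow> rat" n]
    unfolding p(2) [symmetric] by (rule trans [OF sym])
  \<comment> \<open>Dividing by the product of the -j^2 turns the factors into 1 - p / j on one side
    and 4 (1 - p / (2 j)) on the other.\<close>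
  then have "(\<Prod>j = 1..n. of_nat j * of_nat (p - j)) / (\<Prod>j = 1..n. - (of_nat j * of_nat j)) =
      (\<Prod>j = 1..n. of_nat (2 * j) * of_nat (p - 2 * j)) / (\<Prod>j = 1..n. - (of_nat j * of_nat j) :: rat)"
    by (rule arg_cong)
  also have "(\<Prod>j = 1..n. of_nat j * of_nat (p - j)) / (\<Prod>j = 1..n. - (of_nat j * of_nat j)) =
      (\<Prod>j = 1..n. 1 - P / of_nat j)"
    unfolding prod_dividef [symmetric] using p
    by (intro prod.cong refl) (auto simp: P_def field_simps)
  also have "(\<Prod>j = 1..n. of_nat (2 * j) * of_nat (p - 2 * j)) / (\<Prod>j = 1..n. - (of_nat j * of_nat j)) =
      (\<Prod>j = 1..n. 4 * (1 - P / of_nat (2 * j)))"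
    unfolding prod_dividef [symmetric] using p
    by (intro prod.cong refl) (auto simp: P_def field_simps)
  also have "\<dots> = 4 ^ n * (\<Prod>j = 1..n. 1 - P / of_nat (2 * j))"
    by (simp only: prod.distrib prod_constant card_atLeastAtMost) simp
  also have "4 ^ n = 1 + P * Q"
    using P0 p by (simp add: P_def Q_def power_mult)
  finally have "1 - 2 * P * K + 4 * P ^ 2 * E + P ^ 3 * z1 =
      (1 + P * Q) * (1 - P * K + P ^ 2 * E + P ^ 3 * z2)"
    unfolding eq1 eq2 .
  \<comment> \<open>The difference of the two sides has a factor \<open>P\<close>; cancelling it
    leaves a relation modulo p^2.\<close>
  moreover have "P * (P * (3 * E + Q * K) - Q + P\<^sup>2 * (z1 - z2 - Q * E - P * Q * z2) - K) =
      (1 - 2 * P * K + 4 * P ^ 2 * E + P ^ 3 * z1) -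
      (1 + P * Q) * (1 - P * K + P ^ 2 * E + P ^ 3 * z2)"
    by (simp add: algebra_simps power2_eq_square power3_eq_cube)
  ultimately have "P * (3 * E + Q * K) - Q + P\<^sup>2 * (z1 - z2 - Q * E - P * Q * z2) - K = 0"
    using P0 by simp
  then have K_eq: "K = P * (3 * E + Q * K) - Q + P\<^sup>2 * (z1 - z2 - Q * E - P * Q * z2)"
    by (simp only: right_minus_eq)
  \<comment> \<open>A bootstrap: \<open>K = P * h - Q\<close> gives K modulo p, and inserting this
    into the terms with a factor \<open>P\<close> gives K modulo p^2.\<close>
  define w h where "w = z1 - z2 - Q * E - P * Q * z2" and "h = 3 * E + Q * K + P * w"
  have w: "w \<in> p_integral p" and h: "h \<in> p_integral p"
    unfolding w_def h_def P_def by (intro p_integral_intros p(1) z1 z2 Q K E)+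
  have "P * (3 * E + Q * K) - Q + P\<^sup>2 * w = P * h - Q"
    by (simp add: h_def algebra_simps power2_eq_square)
  with K_eq have K_h: "K = P * h - Q"
    unfolding w_def [symmetric] by (rule trans)
  obtain y where y: "y \<in> p_integral p" "hsum 1 2 n = P * y"
    unfolding P_def using rat_congE [OF hsum_2_cong_0 [OF p]] by auto
  have E_eq: "E = K\<^sup>2 / 2 - P * y / 8"
    by (simp add: E_def K_def y(2) field_simps power2_eq_square)
  \<comment> \<open>The factor 8 clears the denominators of \<open>E_eq\<close>.\<close>
  have "8 * K = 8 * (P * (3 * E + Q * K) - Q + P\<^sup>2 * w)"
    using K_eq unfolding w_def [symmetric] by (rule arg_cong)
  also have "\<dots> = P * (24 * E + 8 * Q * K) - 8 * Q + 8 * P\<^sup>2 * w"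
    by (simp add: algebra_simps)
  also have "24 * E = 12 * K\<^sup>2 - 3 * P * y"
    unfolding E_eq by simp
  also have "P * (12 * K\<^sup>2 - 3 * P * y + 8 * Q * K) - 8 * Q + 8 * P\<^sup>2 * w =
      4 * (P * Q\<^sup>2 - 2 * Q) + P\<^sup>2 * (12 * P * h\<^sup>2 - 16 * Q * h - 3 * y + 8 * w)"
    unfolding K_h by (simp add: algebra_simps power2_eq_square)
  finally have "hsum 1 1 n =
      P * Q\<^sup>2 - 2 * Q + P\<^sup>2 * ((12 * P * h\<^sup>2 - 16 * Q * h - 3 * y + 8 * w) / 4)"
    by (simp add: K_def field_simps)
  moreover have "(12 * P * h\<^sup>2 - 16 * Q * h - 3 * y + 8 * w) / 4 \<in> p_integral p"
    unfolding P_def by (intro quarter p_integral_intros p(1) Q h y(1) w)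
  moreover have "P * Q\<^sup>2 - 2 * Q \<in> p_integral p"
    unfolding P_def by (intro p_integral_intros p(1) Q)
  ultimately show ?thesis
    using rat_congI [OF p(1)] unfolding P_def by blast
qed

section \<open>The binomial sum modulo p\<close>

text \<open>A2 enters the relations with a factor p, so they are needed modulo p^2 to determine A2
  modulo p.\<close>

lemma binomial_harm2_cong:
  assumes p: "prime p" "p = 2 * n + 1" "p > 3"
  shows "rat_cong p 1 ((-1) ^ n * (\<Sum>k\<le>n. of_nat (n choose k) * (-2) ^ k * hsum 1 2 k))
    (- (hsum (-1) 2 n / 2))"
proof -
  define P Q A A2 H H2 T :: rat where "P = of_nat p" and "Q = (2 ^ (p - 1) - 1) / P"
    and "A = hsum (-1) 1 n" and "A2 = hsum (-1) 2 n" and "H = hsum 1 1 n" and "H2 = hsum 1 2 n"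
    and "T = (\<Sum>m = 1..n. (-1) ^ m / of_nat m * hsum 1 1 (m - 1))"
  note defs = P_def Q_def A_def A2_def H_def H2_def T_def
  have P0: "P \<noteq> 0"
    using p by (simp add: P_def)
  have half: "x / 2 \<in> p_integral p" if "x \<in> p_integral p" for x
    using p_integral_divide_power_two [OF p(1) _ that, of 1] p(2) by simp
  have A2: "A2 \<in> p_integral p" and P: "P \<in> p_integral p"
    unfolding defs using p by (simp_all add: p_integral_hsum p_integral_intros)
  have T: "T \<in> p_integral p"
    unfolding T_def using p
    by (intro p_integral_sum p_integral_mult p_integral_divide_of_nat p_integral_hsum p_integral_power
        p_integral_uminus p_integral_numeral) (auto dest: dvd_imp_le)
  have Q: "Q \<in> p_integral p"
    using rat_cong_integral(1) [OF fermat_quotient_cong [OF p(1,2)]] by (simp add: defs)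
  obtain a where a: "a \<in> p_integral p" "Q = P * T - A + P\<^sup>2 * a"
    unfolding defs by (rule rat_congE [OF fermat_quotient_cong [OF p(1,2)]])
  obtain b where b: "b \<in> p_integral p" "2 * A + P * A2 = H + P\<^sup>2 * b"
    unfolding defs by (rule rat_congE [OF alternating_hsum_cong [OF p]])
  obtain c where c: "c \<in> p_integral p" "H = P * Q\<^sup>2 - 2 * Q + P\<^sup>2 * c"
    unfolding defs by (rule rat_congE [OF harm_cong [OF p]])
  obtain d where d: "d \<in> p_integral p" "H2 = P * d"
    unfolding defs using rat_congE [OF hsum_2_cong_0 [OF p]] by auto
  define e f where "e = b + c - 2 * a" and "f = T + P * a"
  have A: "A = P * T + P\<^sup>2 * a - Q"
    using a(2) by simp
  have "P * A2 = H + P\<^sup>2 * b - 2 * A"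
    using b(2) by linarith
  also have "\<dots> = P * (Q\<^sup>2 - 2 * T + P * e)"
    unfolding c(2) A by (simp add: e_def algebra_simps power2_eq_square)
  finally have "P * A2 = P * (Q\<^sup>2 - 2 * T + P * e)" .
  then have A2_eq: "A2 = Q\<^sup>2 - 2 * T + P * e"
    using P0 by simp
  have A_eq: "A = P * f - Q"
    unfolding A by (simp add: f_def algebra_simps power2_eq_square)
  have "(-1) ^ n * (\<Sum>k\<le>n. of_nat (n choose k) * (-2) ^ k * hsum 1 2 k) = (A\<^sup>2 + H2) / 2 - T - A2"
    unfolding binomial_sum_harm2 defs ..
  \<comment> \<open>Modulo p, A^2 = Q^2, H2 = 0 and 2 T = Q^2 - A2, hence Q^2 / 2 - T - A2 = - A2 /
    2.\<close>
  also have "\<dots> = - (A2 / 2) + P ^ 1 * ((P * f\<^sup>2 - 2 * Q * f + d - e) / 2)"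
    unfolding A_eq A2_eq d(2) by (simp add: field_simps power2_eq_square)
  finally have "(-1) ^ n * (\<Sum>k\<le>n. of_nat (n choose k) * (-2) ^ k * hsum 1 2 k) =
      - (A2 / 2) + P ^ 1 * ((P * f\<^sup>2 - 2 * Q * f + d - e) / 2)" .
  moreover have "(P * f\<^sup>2 - 2 * Q * f + d - e) / 2 \<in> p_integral p"
    unfolding e_def f_def by (intro half p_integral_intros p(1) P T Q a(1) b(1) c(1) d(1))
  moreover have "- (A2 / 2) \<in> p_integral p"
    by (intro half p_integral_intros p(1) A2)
  ultimately show ?thesis
    using rat_congI [OF p(1)] unfolding A2_def P_def by blast
qed

section \<open>Euler numbers modulo p\<close>

text \<open>In the expansions of (1 + x)^m and (-1 + x)^m the terms with odd k cancel.\<close>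

lemma even_binomial_sum:
  "2 * (\<Sum>k | k \<le> m \<and> even k. of_nat (m choose k) * x ^ (m - k)) = (x + 1) ^ m + (x - 1) ^ m"
  for x :: "'a :: comm_ring_1"
proof -
  have "(x + 1) ^ m + (x - 1) ^ m = (1 + x) ^ m + (- 1 + x) ^ m"
    by (simp add: add.commute)
  also have "\<dots> = (\<Sum>k\<le>m. if even k then 2 * (of_nat (m choose k) * x ^ (m - k)) else 0)"
    unfolding binomial_ring sum.distrib [symmetric] by (intro sum.cong refl) auto
  also have "\<dots> = (\<Sum>k | k \<le> m \<and> even k. 2 * (of_nat (m choose k) * x ^ (m - k)))"
    using sum.inter_filter [of "{..m}" "\<lambda>k. 2 * (of_nat (m choose k) * x ^ (m - k))" even] by simp
  finally show ?thesis
    by (simp add: sum_distrib_left)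
qed

text \<open>This is the sum of (-1)^j (2 j)^m over all integers j with |j| <= n. The term at j = 0
  stands apart as \<open>0 ^ m\<close>, which is 1 for \<open>m = 0\<close>.\<close>

definition alternating_power_sum :: "nat \<Rightarrow> nat \<Rightarrow> int" where
  "alternating_power_sum n m = 0 ^ m + (\<Sum>j = 1..n. (-1) ^ j * ((2 * int j) ^ m + (- (2 * int j)) ^ m))"

lemma alternating_power_sum_0: "alternating_power_sum n 0 = (-1) ^ n"
  by (induction n) (simp_all add: alternating_power_sum_def)

text \<open>
  The alternating sum over \<open>x = -2 n, -2 n + 2, \<dots>, 2 n\<close> of \<open>(x + 1) ^ m + (x - 1) ^ m\<close> telescopes. For
  \<open>p = 2 n + 1\<close> what remains is divisible by \<open>p\<close>, so modulo \<open>p\<close> these power sums satisfy the recursion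
  of the Euler numbers.
\<close>

lemma alternating_power_sum_recursion:
  "2 * (\<Sum>k | k \<le> m \<and> even k. of_nat (m choose k) * alternating_power_sum n (m - k)) =
    (-1) ^ n * ((2 * int n + 1) ^ m + (- (2 * int n + 1)) ^ m)"
proof -
  define g where "g x = (\<Sum>k | k \<le> m \<and> even k. of_nat (m choose k) * x ^ (m - k))" for x :: int
  have g: "2 * g x = (x + 1) ^ m + (x - 1) ^ m" for x
    unfolding g_def by (rule even_binomial_sum)
  have "(\<Sum>k | k \<le> m \<and> even k. of_nat (m choose k) * alternating_power_sum n (m - k)) =
      g 0 + (\<Sum>j = 1..n. (-1) ^ j * (g (2 * int j) + g (- (2 * int j))))"
    unfolding alternating_power_sum_def g_def distrib_left sum.distrib sum_distrib_left
    by (subst (1 2) sum.swap) (simp only: mult.left_commute)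
  then have "2 * (\<Sum>k | k \<le> m \<and> even k. of_nat (m choose k) * alternating_power_sum n (m - k)) =
      2 * g 0 + (\<Sum>j = 1..n. (-1) ^ j * (2 * g (2 * int j) + 2 * g (- (2 * int j))))"
    by (simp add: sum_distrib_left algebra_simps)
  also have "\<dots> = (-1) ^ n * ((2 * int n + 1) ^ m + (- (2 * int n + 1)) ^ m)"
    unfolding g by (induction n) (simp_all add: algebra_simps)
  finally show ?thesis .
qed

text \<open>The factor (-1)^n normalises the value at \<open>m = 0\<close> to 1; after that both
  sides obey the same recursion modulo p.\<close>

lemma euler_num_cong:
  assumes p: "prime p" "p = 2 * n + 1"
  shows "[euler_num m = (-1) ^ n * alternating_power_sum n m] (mod int p)"
proof (induction m rule: less_induct)
  case (less m)
  show ?case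
  proof (cases "m = 0")
    case True
    then show ?thesis
      by (simp add: euler_num_0 alternating_power_sum_0 flip: power_add)
  next
    case False
    let ?S = "alternating_power_sum n" and ?K = "{k. 0 < k \<and> k \<le> m \<and> even k}"
    \<comment> \<open>Here \<open>m > 0\<close> matters: the right side of the recursion consists of
      m-th powers of multiples of p.\<close>
    have pow: "int p dvd x ^ m" if "int p dvd x" for x
      using that dvd_power [of m x] False dvd_trans by blast
    have "int p = 2 * int n + 1"
      unfolding p(2) by simp
    then have "int p dvd 2 * int n + 1"
      by (rule subst) (rule dvd_refl)
    moreover from this have "int p dvd - (2 * int n + 1)"
      by (simp only: dvd_minus_iff)
    ultimately have "int p dvd 2 * (\<Sum>k | k \<le> m \<and> even k. of_nat (m choose k) * ?S (m - k))"
      unfolding alternating_power_sum_recursion by (rule dvd_mult [OF dvd_add [OF pow pow]])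
    moreover have "coprime (int p) 2"
      unfolding p(2) by simp
    ultimately have "int p dvd (\<Sum>k | k \<le> m \<and> even k. of_nat (m choose k) * ?S (m - k))"
      using coprime_dvd_mult_right_iff by blast
    then have "[?S m + (\<Sum>k\<in>?K. of_nat (m choose k) * ?S (m - k)) = 0] (mod int p)"
      by (simp add: cong_0_iff euler_recursion_split)
    then have "[(-1) ^ n * (?S m + (\<Sum>k\<in>?K. of_nat (m choose k) * ?S (m - k))) = (-1) ^ n * 0] (mod int p)"
      by (rule cong_scalar_left)
    then have S: "[(-1) ^ n * ?S m + (\<Sum>k\<in>?K. of_nat (m choose k) * ((-1) ^ n * ?S (m - k))) = 0] (mod int p)"
      by (simp add: distrib_left sum_distrib_left mult.left_commute)
    have "[(\<Sum>k\<in>?K. of_nat (m choose k) * euler_num (m - k)) =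
        (\<Sum>k\<in>?K. of_nat (m choose k) * ((-1) ^ n * ?S (m - k)))] (mod int p)"
      using less by (intro cong_sum cong_scalar_left) auto
    moreover have "euler_num m + (\<Sum>k\<in>?K. of_nat (m choose k) * euler_num (m - k)) = 0"
      using euler_num_recursion [of m] False by (simp add: euler_recursion_split)
    ultimately show ?thesis
      using S by (smt (verit) cong_add_rcancel cong_add cong_refl cong_sym cong_trans)
  qed
qed

text \<open>Fermat's little theorem, divided by the unit k^2.\<close>

lemma power_cong_inverse_square:
  assumes p: "prime p" "p > 3" and k: "\<not> p dvd k"
  shows "rat_cong p 1 (of_nat k ^ (p - 3)) (1 / of_nat k ^ 2)"
proof -
  have "[int k ^ (p - 1) = 1] (mod int p)"
    using fermat_theorem [OF p(1) k] by (metis cong_int_iff of_nat_1 of_nat_power)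
  then have "rat_cong p 1 (of_int (int k ^ (p - 1))) (of_int 1)"
    by (rule rat_cong_of_int [OF p(1)])
  then have "rat_cong p 1 (of_int (int k ^ (p - 1)) * (1 / of_nat k ^ 2)) (of_int 1 * (1 / of_nat k ^ 2))"
    using p k by (intro rat_cong_mult rat_cong_refl p_integral_divide_of_nat_power p_integral_intros)
  moreover have "of_int (int k ^ (p - 1)) * (1 / of_nat k ^ 2) = (of_nat k ^ (p - 3) :: rat)"
  proof -
    have "p - 1 = (p - 3) + 2" "k \<noteq> 0"
      using p k by (auto intro: gr0I)
    then show ?thesis
      by (simp only: power_add) (simp add: power2_eq_square)
  qed
  ultimately show ?thesis
    by (simp only: of_int_1 mult_1_left)
qed

lemma euler_num_cong_hsum:
  assumes p: "prime p" "p = 2 * n + 1" "p > 3"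
  shows "rat_cong p 1 (of_int (euler_num (p - 3))) ((-1) ^ n * (hsum (-1) 2 n / 2))"
proof -
  have ndvd: "\<not> p dvd 2 * j" if "j \<in> {1..n}" for j
    using that p by (auto dest: dvd_imp_le)
  \<comment> \<open>An even exponent merges the terms of j and -j, and a positive one removes
    \<open>0 ^ m\<close>.\<close>
  have "even (p - 3)" "p - 3 > 0"
    using p by auto
  then have S: "of_int ((-1) ^ n * alternating_power_sum n (p - 3)) =
      (-1) ^ n * (\<Sum>j = 1..n. (-1) ^ j * (2 * of_nat (2 * j) ^ (p - 3)) :: rat)"
    by (simp add: alternating_power_sum_def power_0_left mult_ac)
  have "rat_cong p 1 (of_int (euler_num (p - 3))) (of_int ((-1) ^ n * alternating_power_sum n (p - 3)))"
    by (intro rat_cong_of_int euler_num_cong p)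
  also have "rat_cong p 1 (of_int ((-1) ^ n * alternating_power_sum n (p - 3)))
      ((-1) ^ n * (\<Sum>j = 1..n. (-1) ^ j * (2 * (1 / of_nat (2 * j) ^ 2))))"
    unfolding S using p
    by (intro rat_cong_mult rat_cong_sum rat_cong_refl power_cong_inverse_square p_integral_intros ndvd) auto
  also have "(\<Sum>j = 1..n. (-1) ^ j * (2 * (1 / of_nat (2 * j) ^ 2))) = hsum (-1) 2 n / 2"
    unfolding hsum_def sum_divide_distrib
    by (intro sum.cong refl) (simp add: power2_eq_square)
  finally show ?thesis
    using p by blast
qed

section \<open>Combination of the two evaluations\<close>

theorem theorem1p2:
  fixes p :: nat
  assumes "prime p" and "p > 3"
  shows "rat_cong p 1
           (\<Sum>k = 0..p - 1. of_nat ((2 * k) choose k) / 2 ^ k * harm2 k)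
           (of_int (- euler_num (p - 3)))"
proof -
  have "odd p"
    using assms prime_odd_nat by simp
  then obtain n where n: "p = 2 * n + 1"
    by (rule oddE)
  have e: "(-1) ^ n * (-1) ^ n = (1 :: rat)"
    by (simp flip: power_add)
  let ?F = "\<Sum>k\<le>n. of_nat (n choose k) * (-2) ^ k * hsum 1 2 k"
  have "rat_cong p 1 (\<Sum>k = 0..p - 1. of_nat ((2 * k) choose k) / 2 ^ k * harm2 k)
      (\<Sum>k = 0..p - 1. of_nat (n choose k) * (-2) ^ k * hsum 1 2 k)"
    unfolding harm2_eq_hsum using assms n
    by (intro rat_cong_sum rat_cong_mult central_binomial_cong rat_cong_refl p_integral_hsum
        p_integral_numeral) auto
  \<comment> \<open>The terms with \<open>n < k\<close> vanish because
    \<open>n choose k = 0\<close>.\<close>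
  also have "(\<Sum>k = 0..p - 1. of_nat (n choose k) * (-2) ^ k * hsum 1 2 k) = ?F"
    using n by (intro sum.mono_neutral_right) auto
  \<comment> \<open>The sign is inserted twice: the inner one fits
    \<open>binomial_harm2_cong\<close>, the outer one is the sign in
    \<open>euler_num_cong_hsum\<close>.\<close>
  also have "?F = (-1) ^ n * ((-1) ^ n * ?F)"
    by (simp only: mult.assoc [symmetric] e mult_1_left)
  also have "rat_cong p 1 ((-1) ^ n * ((-1) ^ n * ?F)) ((-1) ^ n * (- (hsum (-1) 2 n / 2)))"
    using assms n by (intro rat_cong_mult rat_cong_refl binomial_harm2_cong p_integral_intros)
  also have "(-1) ^ n * (- (hsum (-1) 2 n / 2)) = (-1) * ((-1) ^ n * (hsum (-1) 2 n / 2))"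
    by simp
  also have "rat_cong p 1 ((-1) * ((-1) ^ n * (hsum (-1) 2 n / 2))) ((-1) * of_int (euler_num (p - 3)))"
    using assms n
    by (intro rat_cong_mult rat_cong_refl rat_cong_sym [OF _ euler_num_cong_hsum] p_integral_intros)
  finally show ?thesis
    using assms(1) by simp
qed

end
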